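(* Let $(X,p)$ be a quasi-normed cone and let $Y$ be a subcone of $X$ such that $G_Y$ is closed in $(X,\mathcal{T}(d_p))$. Then the pair $(X/Y,\hat p)$ is a quasi-normed cone, where the function $\hat p: X/Y\to\mathbb{R}^+$ is defined by $\hat p([x])=\inf\{p(x+y) : y\in G_Y\}$.
   Context: $\mathbb{R}^+$ is the set of nonnegative real numbers. A cone (on $\mathbb{R}^+$) is a triple $(X,+,\cdot)$ such that $(X,+)$ is an abelian monoid with neutral element $0$ and $\cdot:\mathbb{R}^+\times X\to X$ satisfies, for all $x,y\in X$ and $r,s\in\mathbb{R}^+$: $r\cdot(s\cdot x)=(rs)\cdot x$; $r\cdot(x+y)=r\cdot x+r\cdot y$; $(r+s)\cdot x=r\cdot x+s\cdot x$; $1\cdot x=x$; $0\cdot x=0$. It is cancellative if $z+x=z+y$ implies $x=y$. A subcone of $X$ is a subset which is a cone under the restricted operations. $-x$ denotes the additive inverse of $x$ when it exists. A quasi-norm on a cone $X$ is a function $q:X\to\mathbb{R}^+$ such that for all $x,y\in X$, $r\in\mathbb{R}^+$: (i) $x=0$ if and only if there is $-x\in X$ and $q(x)=q(-x)=0$; (ii) $q(r\cdot x)=rq(x)$; (iii) $q(x+y)\le q(x)+q(y)$. A quasi-normed cone is a pair $(X,p)$ where $X$ is a cancellative cone and $p$ is a quasi-norm on $X$. Its induced extended quasi-metric is $d_p(x,y)=p(a)$ if $y=x+a$ with $a\in X$, and $d_p(x,y)=+\infty$ if $y\notin x+X$. $\mathcal{T}(d_p)$ is the topology on $X$ with base the balls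 $B_{d_p}(x,r)=\{y\in X: d_p(x,y)<r\}$, $x\in X$, $r>0$. For a subcone $Y$ of $X$, $G_Y=\{y\in Y: -y\in Y\}$, $[x]=\{x+g: g\in G_Y\}$, and $X/Y=\{[x]: x\in X\}$ is the quotient cone with operations $[x]+[z]=[x+z]$, $\lambda\cdot[x]=[\lambda\cdot x]$ ($\lambda\in\mathbb{R}^+$). *)

theory Defs
  imports "HOL-Algebra.Module" "HOL-Analysis.Abstract_Topology" "HOL-Library.Extended_Real"
begin

(* Cones use the record of modules over the reals, of which only carrier, add, zero and
   smult matter; its fields mult and one play no role.  The scalars are the nonnegative
   reals, so nothing is required of r \<odot> x for r < 0. *)

locale abstract_cone = abelian_monoid X for X :: "(real, 'a, 'm) module_scheme" (structure) +
  assumes smult_closed: "0 \<le> r \<Longrightarrow> x \<in> carrier X \<Longrightarrow> r \<odot> x \<in> carrier X"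
    and smult_smult: "0 \<le> r \<Longrightarrow> 0 \<le> s \<Longrightarrow> x \<in> carrier X \<Longrightarrow> r \<odot> (s \<odot> x) = (r * s) \<odot> x"
    and smult_add: "0 \<le> r \<Longrightarrow> x \<in> carrier X \<Longrightarrow> y \<in> carrier X \<Longrightarrow>
      r \<odot> (x \<oplus> y) = r \<odot> x \<oplus> r \<odot> y"
    and add_smult: "0 \<le> r \<Longrightarrow> 0 \<le> s \<Longrightarrow> x \<in> carrier X \<Longrightarrow>
      (r + s) \<odot> x = r \<odot> x \<oplus> s \<odot> x"
    and one_smult: "x \<in> carrier X \<Longrightarrow> 1 \<odot> x = x"
    and zero_smult: "x \<in> carrier X \<Longrightarrow> 0 \<odot> x = \<zero>"

locale cancellative_cone = abstract_cone +
  assumes cancel: "x \<in> carrier X \<Longrightarrow> y \<in> carrier X \<Longrightarrow> z \<in> carrier X \<Longrightarrow>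
    z \<oplus> x = z \<oplus> y \<Longrightarrow> x = y"

definition subcone :: "'a set \<Rightarrow> (real, 'a, 'm) module_scheme \<Rightarrow> bool" where
  "subcone Y X \<longleftrightarrow> Y \<subseteq> carrier X \<and> abstract_cone (X\<lparr>carrier := Y\<rparr>)"

locale quasi_normed_cone = cancellative_cone +
  fixes p :: "'a \<Rightarrow> real"
  assumes qnorm_nonneg: "x \<in> carrier X \<Longrightarrow> 0 \<le> p x"
    and qnorm_zero_iff: "x \<in> carrier X \<Longrightarrow>
      x = \<zero> \<longleftrightarrow> (\<exists>x'\<in>carrier X. x \<oplus> x' = \<zero> \<and> p x = 0 \<and> p x' = 0)"
    and qnorm_smult: "0 \<le> r \<Longrightarrow> x \<in> carrier X \<Longrightarrow> p (r \<odot> x) = r * p x"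
    and qnorm_triangle: "x \<in> carrier X \<Longrightarrow> y \<in> carrier X \<Longrightarrow> p (x \<oplus> y) \<le> p x + p y"

(* In a cancellative cone the element a with y = x \<oplus> a is unique if it exists. *)
definition qdist :: "(real, 'a, 'm) module_scheme \<Rightarrow> ('a \<Rightarrow> real) \<Rightarrow> 'a \<Rightarrow> 'a \<Rightarrow> ereal" where
  "qdist X p x y =
    (if \<exists>a\<in>carrier X. y = x \<oplus>\<^bsub>X\<^esub> a then ereal (p (THE a. a \<in> carrier X \<and> y = x \<oplus>\<^bsub>X\<^esub> a))
     else \<infinity>)"

definition qball :: "(real, 'a, 'm) module_scheme \<Rightarrow> ('a \<Rightarrow> real) \<Rightarrow> 'a \<Rightarrow> real \<Rightarrow> 'a set" where
  "qball X p x r = {y \<in> carrier X. qdist X p x y < ereal r}"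

definition qtopology :: "(real, 'a, 'm) module_scheme \<Rightarrow> ('a \<Rightarrow> real) \<Rightarrow> 'a topology" where
  "qtopology X p =
    topology (arbitrary union_of (\<lambda>U. \<exists>x\<in>carrier X. \<exists>r>0. U = qball X p x r))"

definition inv_part :: "(real, 'a, 'm) module_scheme \<Rightarrow> 'a set \<Rightarrow> 'a set" where
  "inv_part X Y = {y \<in> Y. \<exists>z\<in>Y. y \<oplus>\<^bsub>X\<^esub> z = \<zero>\<^bsub>X\<^esub>}"

definition cls :: "(real, 'a, 'm) module_scheme \<Rightarrow> 'a set \<Rightarrow> 'a \<Rightarrow> 'a set" where
  "cls X Y x = {x \<oplus>\<^bsub>X\<^esub> g | g. g \<in> inv_part X Y}"

(* The operations are given by unions over all representatives of the classes; see
   quot_cone_add and quot_cone_smult below for their values on classes. *)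
definition quot_cone :: "(real, 'a, 'm) module_scheme \<Rightarrow> 'a set \<Rightarrow> (real, 'a set) module" where
  "quot_cone X Y =
    \<lparr>carrier = cls X Y ` carrier X,
     mult = undefined,
     one = undefined,
     zero = cls X Y \<zero>\<^bsub>X\<^esub>,
     add = (\<lambda>A B. \<Union>x\<in>A. \<Union>z\<in>B. cls X Y (x \<oplus>\<^bsub>X\<^esub> z)),
     smult = (\<lambda>r A. \<Union>x\<in>A. cls X Y (r \<odot>\<^bsub>X\<^esub> x))\<rparr>"

(* A class A = cls X Y x is itself the set of all x \<oplus> y with y in inv_part X Y. *)
definition quot_qnorm :: "('a \<Rightarrow> real) \<Rightarrow> 'a set \<Rightarrow> real" where
  "quot_qnorm p A = (INF a\<in>A. p a)"

lemma quot_qnorm_cls: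
  "quot_qnorm p (cls X Y x) = Inf {p (x \<oplus>\<^bsub>X\<^esub> y) | y. y \<in> inv_part X Y}"
proof -
  have "p ` cls X Y x = {p (x \<oplus>\<^bsub>X\<^esub> y) | y. y \<in> inv_part X Y}"
    by (auto simp: cls_def)
  then show ?thesis by (simp add: quot_qnorm_def)
qed

lemma subcone_subset: "subcone Y X \<Longrightarrow> Y \<subseteq> carrier X"
  by (simp add: subcone_def)

lemma subcone_add: "subcone Y X \<Longrightarrow> x \<in> Y \<Longrightarrow> y \<in> Y \<Longrightarrow> x \<oplus>\<^bsub>X\<^esub> y \<in> Y"
  using abelian_monoid.a_closed[of "X\<lparr>carrier := Y\<rparr>" x y]
  by (simp add: subcone_def abstract_cone_def)

lemma subcone_zero: "subcone Y X \<Longrightarrow> \<zero>\<^bsub>X\<^esub> \<in> Y"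
  using abelian_monoid.zero_closed[of "X\<lparr>carrier := Y\<rparr>"]
  by (simp add: subcone_def abstract_cone_def)

lemma subcone_smult: "subcone Y X \<Longrightarrow> 0 \<le> r \<Longrightarrow> x \<in> Y \<Longrightarrow> r \<odot>\<^bsub>X\<^esub> x \<in> Y"
  using abstract_cone.smult_closed[of "X\<lparr>carrier := Y\<rparr>" r x]
  by (simp add: subcone_def)

context abstract_cone
begin

lemma smult_zero_right: "0 \<le> r \<Longrightarrow> r \<odot> \<zero> = \<zero>"
  using smult_smult[of r 0 \<zero>] zero_smult[of \<zero>] by simp

lemma inv_part_carrier: "subcone Y X \<Longrightarrow> g \<in> inv_part X Y \<Longrightarrow> g \<in> carrier X"
  using subcone_subset by (auto simp: inv_part_def)

lemma inv_part_zero: "subcone Y X \<Longrightarrow> \<zero> \<in> inv_part X Y"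
  using subcone_zero by (force simp: inv_part_def)

lemma inv_part_add:
  assumes Y: "subcone Y X" and g: "g \<in> inv_part X Y" and h: "h \<in> inv_part X Y"
  shows "g \<oplus> h \<in> inv_part X Y"
proof -
  obtain g' h' where g': "g' \<in> Y" "g \<oplus> g' = \<zero>" and h': "h' \<in> Y" "h \<oplus> h' = \<zero>"
    using g h by (auto simp: inv_part_def)
  have gY: "g \<in> Y" "h \<in> Y" using g h by (auto simp: inv_part_def)
  have c: "g \<in> carrier X" "h \<in> carrier X" "g' \<in> carrier X" "h' \<in> carrier X"
    using gY g' h' subcone_subset[OF Y] by auto
  have "(g \<oplus> h) \<oplus> (g' \<oplus> h') = (g \<oplus> g') \<oplus> (h \<oplus> h')"
    using c by (simp add: a_ac)
  then have "(g \<oplus> h) \<oplus> (g' \<oplus> h') = \<zero>" using g' h' by simp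
  then show ?thesis
    using subcone_add[OF Y] gY g' h' by (auto simp: inv_part_def)
qed

lemma inv_part_smult:
  assumes Y: "subcone Y X" and g: "g \<in> inv_part X Y" and r: "0 \<le> r"
  shows "r \<odot> g \<in> inv_part X Y"
proof -
  obtain g' where g': "g' \<in> Y" "g \<oplus> g' = \<zero>" "g \<in> Y"
    using g by (auto simp: inv_part_def)
  then have "g \<in> carrier X" "g' \<in> carrier X" using subcone_subset[OF Y] by auto
  then have "r \<odot> g \<oplus> r \<odot> g' = r \<odot> (g \<oplus> g')" by (simp add: smult_add[OF r])
  then have "r \<odot> g \<oplus> r \<odot> g' = \<zero>" using g' smult_zero_right[OF r] by simp
  then show ?thesis using subcone_smult[OF Y r] g' by (auto simp: inv_part_def)
qed

lemma cls_self: "subcone Y X \<Longrightarrow> x \<in> carrier X \<Longrightarrow> x \<in> cls X Y x"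
  using inv_part_zero by (force simp: cls_def)

lemma cls_absorb:
  assumes Y: "subcone Y X" and x: "x \<in> carrier X" and g: "g \<in> inv_part X Y"
  shows "cls X Y (x \<oplus> g) = cls X Y x"
proof
  have gc: "g \<in> carrier X" using inv_part_carrier[OF Y g] .
  show "cls X Y (x \<oplus> g) \<subseteq> cls X Y x"
  proof
    fix a assume "a \<in> cls X Y (x \<oplus> g)"
    then obtain h where h: "h \<in> inv_part X Y" "a = (x \<oplus> g) \<oplus> h" by (auto simp: cls_def)
    then have "a = x \<oplus> (g \<oplus> h)" using x gc inv_part_carrier[OF Y h(1)] by (simp add: a_assoc)
    then show "a \<in> cls X Y x" using inv_part_add[OF Y g h(1)] by (auto simp: cls_def)
  qed
  obtain g' where g': "g' \<in> Y" "g \<oplus> g' = \<zero>" "g \<in> Y" using g by (auto simp: inv_part_def)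
  have g'c: "g' \<in> carrier X" using g' subcone_subset[OF Y] by auto
  have "g' \<oplus> g = \<zero>" using g'(2) a_comm[OF g'c gc] by simp
  then have g'i: "g' \<in> inv_part X Y" using g' by (auto simp: inv_part_def)
  show "cls X Y x \<subseteq> cls X Y (x \<oplus> g)"
  proof
    fix a assume "a \<in> cls X Y x"
    then obtain h where h: "h \<in> inv_part X Y" "a = x \<oplus> h" by (auto simp: cls_def)
    have hc: "h \<in> carrier X" using inv_part_carrier[OF Y h(1)] .
    have "(x \<oplus> g) \<oplus> (g' \<oplus> h) = x \<oplus> ((g \<oplus> g') \<oplus> h)"
      using x gc g'c hc by (simp add: a_assoc)
    then have "a = (x \<oplus> g) \<oplus> (g' \<oplus> h)" using g'(2) hc h(2) by simp
    then show "a \<in> cls X Y (x \<oplus> g)" using inv_part_add[OF Y g'i h(1)] by (auto simp: cls_def)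
  qed
qed

lemma quot_cone_add:
  assumes Y: "subcone Y X" and x: "x \<in> carrier X" and z: "z \<in> carrier X"
  shows "cls X Y x \<oplus>\<^bsub>quot_cone X Y\<^esub> cls X Y z = cls X Y (x \<oplus> z)"
proof -
  have eq: "cls X Y (a \<oplus> b) = cls X Y (x \<oplus> z)"
    if "a \<in> cls X Y x" "b \<in> cls X Y z" for a b
  proof -
    obtain g h where g: "g \<in> inv_part X Y" "a = x \<oplus> g" and h: "h \<in> inv_part X Y" "b = z \<oplus> h"
      using \<open>a \<in> cls X Y x\<close> \<open>b \<in> cls X Y z\<close> by (auto simp: cls_def)
    have "a \<oplus> b = (x \<oplus> z) \<oplus> (g \<oplus> h)"
      using x z g h inv_part_carrier[OF Y] by (simp add: a_ac)
    then show ?thesis using cls_absorb[OF Y _ inv_part_add[OF Y g(1) h(1)]] x z by simp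
  qed
  have "(\<Union>a\<in>cls X Y x. \<Union>b\<in>cls X Y z. cls X Y (a \<oplus> b))
      = (\<Union>a\<in>cls X Y x. \<Union>b\<in>cls X Y z. cls X Y (x \<oplus> z))"
    by (intro SUP_cong refl eq)
  also have "\<dots> = cls X Y (x \<oplus> z)"
    using cls_self[OF Y x] cls_self[OF Y z] by blast
  finally show ?thesis by (simp add: quot_cone_def)
qed

lemma quot_cone_smult:
  assumes Y: "subcone Y X" and x: "x \<in> carrier X" and r: "0 \<le> r"
  shows "r \<odot>\<^bsub>quot_cone X Y\<^esub> cls X Y x = cls X Y (r \<odot> x)"
proof -
  have eq: "cls X Y (r \<odot> a) = cls X Y (r \<odot> x)" if "a \<in> cls X Y x" for a
  proof -
    obtain g where g: "g \<in> inv_part X Y" "a = x \<oplus> g"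
      using \<open>a \<in> cls X Y x\<close> by (auto simp: cls_def)
    have "r \<odot> a = r \<odot> x \<oplus> r \<odot> g"
      using smult_add[OF r x] g inv_part_carrier[OF Y] by simp
    then show ?thesis
      using cls_absorb[OF Y _ inv_part_smult[OF Y g(1) r]] smult_closed[OF r x] by simp
  qed
  have "(\<Union>a\<in>cls X Y x. cls X Y (r \<odot> a)) = (\<Union>a\<in>cls X Y x. cls X Y (r \<odot> x))"
    by (intro SUP_cong refl eq)
  also have "\<dots> = cls X Y (r \<odot> x)"
    using cls_self[OF Y x] by blast
  finally show ?thesis by (simp add: quot_cone_def)
qed

end

context quasi_normed_cone
begin

lemma qnorm_zero: "p \<zero> = 0"
  using qnorm_smult[of 0 \<zero>] zero_smult[of \<zero>] by simp

lemma qdist_add: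
  assumes "x \<in> carrier X" "a \<in> carrier X"
  shows "qdist X p x (x \<oplus> a) = ereal (p a)"
proof -
  have "(THE b. b \<in> carrier X \<and> x \<oplus> a = x \<oplus> b) = a"
    using assms cancel by (intro the_equality) blast+
  then show ?thesis using assms by (auto simp: qdist_def)
qed

lemma mem_qball:
  assumes "x \<in> carrier X"
  shows "y \<in> qball X p x r \<longleftrightarrow> (\<exists>a\<in>carrier X. y = x \<oplus> a \<and> p a < r)"
proof
  assume y: "y \<in> qball X p x r"
  then obtain a where "a \<in> carrier X" "y = x \<oplus> a"
    by (auto simp: qball_def qdist_def split: if_splits)
  with y qdist_add[OF assms] show "\<exists>a\<in>carrier X. y = x \<oplus> a \<and> p a < r"
    by (auto simp: qball_def)
qed (use assms qdist_add[OF assms] in \<open>auto simp: qball_def\<close>)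

lemma istopology_qballs:
  "istopology (arbitrary union_of (\<lambda>U. \<exists>x\<in>carrier X. \<exists>r>0. U = qball X p x r))"
proof -
  let ?P = "\<lambda>U. \<exists>x\<in>carrier X. \<exists>r>0. U = qball X p x r"
  have "(arbitrary union_of ?P) (S \<inter> T)" if "?P S" "?P T" for S T
    unfolding arbitrary_union_of_alt
  proof
    obtain x r y s where x: "x \<in> carrier X" "S = qball X p x r"
      and y: "y \<in> carrier X" "T = qball X p y s"
      using \<open>?P S\<close> \<open>?P T\<close> by auto
    fix z assume z: "z \<in> S \<inter> T"
    then obtain a b where a: "a \<in> carrier X" "z = x \<oplus> a" "p a < r"
      and b: "b \<in> carrier X" "z = y \<oplus> b" "p b < s"
      using x y by (auto simp: mem_qball)
    have zc: "z \<in> carrier X" using x a by simp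
    define e where "e = min (r - p a) (s - p b)"
    have e: "0 < e" using a b by (simp add: e_def)
    have "qball X p z e \<subseteq> S \<inter> T"
    proof
      fix w assume "w \<in> qball X p z e"
      then obtain c where c: "c \<in> carrier X" "w = z \<oplus> c" "p c < e"
        using zc by (auto simp: mem_qball)
      have "w = x \<oplus> (a \<oplus> c)" using x(1) a c by (simp add: a_assoc)
      moreover have "w = y \<oplus> (b \<oplus> c)" using y(1) b c by (simp add: a_assoc)
      moreover have "p (a \<oplus> c) < r" "p (b \<oplus> c) < s"
        using qnorm_triangle[OF a(1) c(1)] qnorm_triangle[OF b(1) c(1)] c(3)
        by (auto simp: e_def)
      moreover have "a \<oplus> c \<in> carrier X" "b \<oplus> c \<in> carrier X" using a b c by auto
      ultimately show "w \<in> S \<inter> T" using x y by (auto simp: mem_qball)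
    qed
    moreover have "z \<in> qball X p z e"
      using zc e qnorm_zero by (auto simp: mem_qball intro!: bexI[of _ \<zero>])
    ultimately show "\<exists>U. ?P U \<and> z \<in> U \<and> U \<subseteq> S \<inter> T" using zc e by blast
  qed
  then show ?thesis unfolding istopology_base_eq by blast
qed

lemma openin_qtopology:
  "openin (qtopology X p) =
    arbitrary union_of (\<lambda>U. \<exists>x\<in>carrier X. \<exists>r>0. U = qball X p x r)"
  unfolding qtopology_def by (rule topology_inverse'[OF istopology_qballs])

end

end

(* Cone axioms and cancellation pass from X to X/Y because two classes agree iff their
   representatives differ by an element of G_Y.  For the zero axiom of the quotient
   quasi-norm, suppose [x] + [x'] = 0.  Then the inverse of x in X is a representative of [x'],
   so if the quasi-norm of [x'] vanishes, there are elements of G_Y at arbitrarily small distance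
   from x.  As G_Y is closed, x lies in G_Y, that is, [x] = 0. *)
theory Submission
  imports Defs
begin

section \<open>Cone structure and cancellation in the quotient\<close>

context abstract_cone
begin

text \<open>This turns equalities in the quotient into equations in \<open>X\<close>. Since G_Y
  contains \<open>\<zero>\<close>, the element \<open>x\<close> lies in its own class; the converse
  is absorption of \<open>g\<close>.\<close>

lemma cls_eq_iff:
  assumes Y: "subcone Y X" and x: "x \<in> carrier X" and y: "y \<in> carrier X"
  shows "cls X Y x = cls X Y y \<longleftrightarrow> (\<exists>g\<in>inv_part X Y. x = y \<oplus> g)"
proof
  assume "cls X Y x = cls X Y y"
  then have "x \<in> cls X Y y" using cls_self[OF Y x] by simp
  then show "\<exists>g\<in>inv_part X Y. x = y \<oplus> g" by (auto simp: cls_def)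
qed (use cls_absorb[OF Y y] in blast)

lemma cls_subset_carrier:
  "subcone Y X \<Longrightarrow> x \<in> carrier X \<Longrightarrow> cls X Y x \<subseteq> carrier X"
  using inv_part_carrier by (auto simp: cls_def)

lemma cls_eq_of_mem:
  "subcone Y X \<Longrightarrow> x \<in> carrier X \<Longrightarrow> a \<in> cls X Y x \<Longrightarrow> cls X Y a = cls X Y x"
  using cls_absorb by (subst (asm) cls_def) auto

lemma carrier_quot_cone: "carrier (quot_cone X Y) = cls X Y ` carrier X"
  by (simp add: quot_cone_def)

lemma zero_quot_cone: "\<zero>\<^bsub>quot_cone X Y\<^esub> = cls X Y \<zero>"
  by (simp add: quot_cone_def)

text \<open>Evaluated on representatives, each axiom is the class map applied to both sides of the
  same axiom of \<open>X\<close>.\<close>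

lemma abstract_cone_quot_cone:
  assumes Y: "subcone Y X"
  shows "abstract_cone (quot_cone X Y)"
proof -
  note quot_simps = carrier_quot_cone zero_quot_cone quot_cone_add[OF Y] quot_cone_smult[OF Y]
  have "abelian_monoid (quot_cone X Y)"
    by (rule abelian_monoidI) (auto simp: quot_simps a_ac)
  then show ?thesis
    by (intro abstract_cone.intro abstract_cone_axioms.intro)
       (auto simp: quot_simps smult_closed smult_smult smult_add add_smult one_smult zero_smult)
qed

end

text \<open>Equality of the classes of \<open>z \<oplus> x\<close> and \<open>z \<oplus> y\<close>
  holds in \<open>X\<close> only up to some \<open>g\<close> in G_Y. Attaching \<open>g\<close> to
  \<open>y\<close> by associativity lets \<open>z\<close> be cancelled in \<open>X\<close>.\<close>

lemma (in cancellative_cone) cancellative_cone_quot_cone: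
  assumes Y: "subcone Y X"
  shows "cancellative_cone (quot_cone X Y)"
proof -
  have *: "cls X Y x = cls X Y y"
    if x: "x \<in> carrier X" and y: "y \<in> carrier X" and z: "z \<in> carrier X"
      and eq: "cls X Y (z \<oplus> x) = cls X Y (z \<oplus> y)" for x y z
  proof -
    obtain g where g: "g \<in> inv_part X Y" "z \<oplus> x = (z \<oplus> y) \<oplus> g"
      using eq x y z by (auto simp: cls_eq_iff[OF Y])
    have gc: "g \<in> carrier X" using inv_part_carrier[OF Y g(1)] .
    have "z \<oplus> x = z \<oplus> (y \<oplus> g)" using g(2) x y z gc by (simp add: a_assoc)
    then have "x = y \<oplus> g" using cancel x y z gc by blast
    then show ?thesis using cls_absorb[OF Y y g(1)] by simp
  qed
  show ?thesis
    by (intro cancellative_cone.intro abstract_cone_quot_cone[OF Y] cancellative_cone_axioms.intro)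
       (unfold carrier_quot_cone, elim imageE, simp add: quot_cone_add[OF Y], rule *)
qed

section \<open>The quasi-norm of a class as an infimum over its representatives\<close>

context quasi_normed_cone
begin

lemma quot_qnorm_le:
  assumes Y: "subcone Y X" and x: "x \<in> carrier X" and a: "a \<in> cls X Y x"
  shows "quot_qnorm p (cls X Y x) \<le> p a"
proof -
  have "bdd_below (p ` cls X Y x)"
    using qnorm_nonneg cls_subset_carrier[OF Y x] by (intro bdd_belowI2[where m = 0]) auto
  then show ?thesis unfolding quot_qnorm_def using a by (rule cINF_lower)
qed

text \<open>A class is nonempty, as it contains \<open>x\<close>, so its infimum is a genuine
  greatest lower bound. Together with \<open>quot_qnorm_le\<close> this carries the estimates
  below.\<close>

lemma quot_qnorm_greatest:
  assumes "subcone Y X" and "x \<in> carrier X" and "\<And>a. a \<in> cls X Y x \<Longrightarrow> c \<le> p a"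
  shows "c \<le> quot_qnorm p (cls X Y x)"
  unfolding quot_qnorm_def using cls_self assms by (intro cINF_greatest) auto

lemma quot_qnorm_nonneg:
  "subcone Y X \<Longrightarrow> x \<in> carrier X \<Longrightarrow> 0 \<le> quot_qnorm p (cls X Y x)"
  using cls_subset_carrier qnorm_nonneg by (intro quot_qnorm_greatest) blast+

lemma quot_qnorm_zero: "subcone Y X \<Longrightarrow> quot_qnorm p (cls X Y \<zero>) = 0"
  using quot_qnorm_le[OF _ zero_closed cls_self[OF _ zero_closed]]
    quot_qnorm_nonneg[OF _ zero_closed] qnorm_zero
  by fastforce

text \<open>The sum of representatives \<open>a\<close> of [x] and \<open>b\<close> of [z]
  represents [x + z], so the left side is at most \<open>p a + p b\<close>.\<close>

lemma quot_qnorm_add: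
  assumes Y: "subcone Y X" and x: "x \<in> carrier X" and z: "z \<in> carrier X"
  shows "quot_qnorm p (cls X Y (x \<oplus> z)) \<le> quot_qnorm p (cls X Y x) + quot_qnorm p (cls X Y z)"
proof -
  have *: "quot_qnorm p (cls X Y (x \<oplus> z)) \<le> p a + p b"
    if a: "a \<in> cls X Y x" and b: "b \<in> cls X Y z" for a b
  proof -
    have c: "a \<in> carrier X" "b \<in> carrier X" using a b cls_subset_carrier[OF Y] x z by auto
    have "cls X Y (a \<oplus> b) = cls X Y (x \<oplus> z)"
      using quot_cone_add[OF Y c] quot_cone_add[OF Y x z]
        cls_eq_of_mem[OF Y x a] cls_eq_of_mem[OF Y z b] by simp
    then have "quot_qnorm p (cls X Y (x \<oplus> z)) \<le> p (a \<oplus> b)"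
      using cls_self[OF Y, of "a \<oplus> b"] c quot_qnorm_le[OF Y] x z by simp
    also have "\<dots> \<le> p a + p b" using qnorm_triangle c by blast
    finally show ?thesis .
  qed
  \<comment> \<open>The infima are taken one at a time: over \<open>b\<close> with \<open>a\<close>
    fixed, then over \<open>a\<close>.\<close>
  have "quot_qnorm p (cls X Y (x \<oplus> z)) - p a \<le> quot_qnorm p (cls X Y z)"
    if "a \<in> cls X Y x" for a
    using *[OF that] by (intro quot_qnorm_greatest[OF Y z]) (simp add: algebra_simps)
  then have "quot_qnorm p (cls X Y (x \<oplus> z)) - quot_qnorm p (cls X Y z)
      \<le> quot_qnorm p (cls X Y x)"
    by (intro quot_qnorm_greatest[OF Y x]) (simp add: algebra_simps)
  then show ?thesis by simp
qed

text \<open>For positive scalars the inequality \<le> suffices: applied to \<open>inverse r\<close>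
  and \<open>r \<odot> x\<close>, it yields the reverse one. The use of \<open>inverse r\<close>
  forces the separate case \<open>r = 0\<close>.\<close>

lemma quot_qnorm_smult:
  assumes Y: "subcone Y X" and x: "x \<in> carrier X" and r: "0 \<le> r"
  shows "quot_qnorm p (cls X Y (r \<odot> x)) = r * quot_qnorm p (cls X Y x)"
proof (cases "r = 0")
  case True
  then show ?thesis using zero_smult[OF x] quot_qnorm_zero[OF Y] by simp
next
  case False
  have *: "quot_qnorm p (cls X Y (s \<odot> y)) \<le> s * quot_qnorm p (cls X Y y)"
    if s: "0 < s" and y: "y \<in> carrier X" for s y
  proof -
    have sy: "s \<odot> y \<in> carrier X" using smult_closed s y by simp
    \<comment> \<open>Dividing by \<open>s\<close> turns the left side into a lower bound of
      \<open>p\<close> on the class of \<open>y\<close>.\<close>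
    have "quot_qnorm p (cls X Y (s \<odot> y)) / s \<le> p a" if a: "a \<in> cls X Y y" for a
    proof -
      have c: "a \<in> carrier X" using a cls_subset_carrier[OF Y y] by auto
      have "cls X Y (s \<odot> a) = cls X Y (s \<odot> y)"
        using quot_cone_smult[OF Y c] quot_cone_smult[OF Y y] cls_eq_of_mem[OF Y y a] s
        by (metis less_imp_le)
      then have "s \<odot> a \<in> cls X Y (s \<odot> y)"
        using cls_self[OF Y, of "s \<odot> a"] smult_closed c s by simp
      then have "quot_qnorm p (cls X Y (s \<odot> y)) \<le> s * p a"
        using quot_qnorm_le[OF Y sy] qnorm_smult[of s a] s c by fastforce
      then show ?thesis using s by (simp add: field_simps)
    qed
    then have "quot_qnorm p (cls X Y (s \<odot> y)) / s \<le> quot_qnorm p (cls X Y y)"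
      by (rule quot_qnorm_greatest[OF Y y])
    then show ?thesis using s by (simp add: field_simps)
  qed
  have r: "0 < r" using r False by simp
  have "inverse r \<odot> (r \<odot> x) = x" using smult_smult[of "inverse r" r x] one_smult x r by simp
  then have "quot_qnorm p (cls X Y x) \<le> inverse r * quot_qnorm p (cls X Y (r \<odot> x))"
    using *[of "inverse r" "r \<odot> x"] smult_closed[of r x] r x by simp
  then have "r * quot_qnorm p (cls X Y x) \<le> quot_qnorm p (cls X Y (r \<odot> x))"
    using r by (simp add: field_simps)
  then show ?thesis using *[OF r x] by simp
qed

section \<open>Open sets of the quasi-metric topology and the closedness of G_Y\<close>

lemma openin_qtopology_ball:
  assumes U: "openin (qtopology X p) U" and x: "x \<in> U"
  obtains e where "0 < e" "qball X p x e \<subseteq> U"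
proof -
  obtain y r where y: "y \<in> carrier X" "x \<in> qball X p y r" "qball X p y r \<subseteq> U"
    using U x unfolding openin_qtopology arbitrary_union_of_alt by auto
  then obtain a where a: "a \<in> carrier X" "x = y \<oplus> a" "p a < r" by (auto simp: mem_qball)
  \<comment> \<open>The basic ball around \<open>y\<close> need not be centred at \<open>x\<close>.
    The triangle inequality recentres it with the remaining radius, positive since
    \<open>p a < r\<close>.\<close>
  have "qball X p x (r - p a) \<subseteq> qball X p y r"
  proof
    fix w assume "w \<in> qball X p x (r - p a)"
    then obtain c where c: "c \<in> carrier X" "w = x \<oplus> c" "p c < r - p a"
      using y a by (auto simp: mem_qball)
    have "w = y \<oplus> (a \<oplus> c)" "p (a \<oplus> c) < r"
      using y a c qnorm_triangle[OF a(1) c(1)] by (auto simp: a_assoc)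
    then show "w \<in> qball X p y r" using a c y by (auto simp: mem_qball)
  qed
  then show ?thesis using that[of "r - p a"] a y by auto
qed

text \<open>Each point lies in its own unit ball because \<open>p \<zero> = 0\<close>. This
  identifies the complement of G_Y in \<open>carrier X\<close> as the open set to work with.\<close>

lemma topspace_qtopology: "topspace (qtopology X p) = carrier X"
proof
  show "topspace (qtopology X p) \<subseteq> carrier X"
    using openin_topspace[of "qtopology X p"]
    unfolding openin_qtopology arbitrary_union_of_alt by (auto simp: qball_def)
  show "carrier X \<subseteq> topspace (qtopology X p)"
  proof
    fix x assume x: "x \<in> carrier X"
    have "openin (qtopology X p) (qball X p x 1)"
      unfolding openin_qtopology using x
      by (intro arbitrary_union_of_inc bexI[of _ x] exI[of _ 1]) auto
    moreover have "x \<in> qball X p x 1"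
      using x qnorm_zero by (auto simp: mem_qball intro!: bexI[of _ \<zero>])
    ultimately show "x \<in> topspace (qtopology X p)" using openin_subset by blast
  qed
qed

lemma cls_eq_zero_of_quot_qnorm_eq_zero:
  assumes Y: "subcone Y X" and closed: "closedin (qtopology X p) (inv_part X Y)"
    and x: "x \<in> carrier X" and x': "x' \<in> carrier X"
    and inv: "cls X Y (x \<oplus> x') = cls X Y \<zero>" and q: "quot_qnorm p (cls X Y x') = 0"
  shows "cls X Y x = cls X Y \<zero>"
proof -
  have "x \<in> inv_part X Y"
  proof (rule ccontr)
    assume "x \<notin> inv_part X Y"
    moreover have "openin (qtopology X p) (carrier X - inv_part X Y)"
      using closed by (simp add: closedin_def topspace_qtopology)
    ultimately obtain e where e: "0 < e" "qball X p x e \<subseteq> carrier X - inv_part X Y"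
      using openin_qtopology_ball x by blast
    \<comment> \<open>Otherwise \<open>e\<close> would be a positive lower bound of \<open>p\<close>
      on a class with infimum 0. Representatives of [x'] matter here because the distance from
      \<open>x\<close> to \<open>x \<oplus> a\<close> is \<open>p a\<close>.\<close>
    obtain a where a: "a \<in> cls X Y x'" "p a < e"
      using quot_qnorm_greatest[OF Y x', of e] q e(1) by force
    have ac: "a \<in> carrier X" using a(1) cls_subset_carrier[OF Y x'] by blast
    \<comment> \<open>Replacing \<open>x'\<close> by \<open>a\<close> does not change the class of
      the sum, so \<open>x \<oplus> a\<close> falls into G_Y.\<close>
    have "cls X Y (x \<oplus> a) = cls X Y \<zero>"
      using quot_cone_add[OF Y x ac] quot_cone_add[OF Y x x'] cls_eq_of_mem[OF Y x' a(1)] inv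
      by simp
    then obtain g where "g \<in> inv_part X Y" "x \<oplus> a = \<zero> \<oplus> g"
      using x ac by (auto simp: cls_eq_iff[OF Y])
    then have "x \<oplus> a \<in> inv_part X Y" using inv_part_carrier[OF Y] by simp
    moreover have "x \<oplus> a \<in> qball X p x e" using x ac a(2) by (auto simp: mem_qball)
    ultimately show False using e(2) by blast
  qed
  then show ?thesis using cls_absorb[OF Y zero_closed, of x] x by simp
qed

end

theorem proposition8:
  fixes X :: "(real, 'a, 'm) module_scheme" and p :: "'a \<Rightarrow> real" and Y :: "'a set"
  assumes "quasi_normed_cone X p"
    and "subcone Y X"
    and "closedin (qtopology X p) (inv_part X Y)"
  shows "quasi_normed_cone (quot_cone X Y) (quot_qnorm p)"
proof -
  interpret quasi_normed_cone X p by fact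
  note Y = assms(2)
  note quot_simps = carrier_quot_cone zero_quot_cone quot_cone_add[OF Y] quot_cone_smult[OF Y]
  \<comment> \<open>Condition (i) for the quotient, expressed on representatives.\<close>
  have zero_iff: "cls X Y x = cls X Y \<zero>\<^bsub>X\<^esub> \<longleftrightarrow> (\<exists>x'\<in>carrier X. cls X Y (x \<oplus>\<^bsub>X\<^esub> x') = cls X Y \<zero>\<^bsub>X\<^esub> \<and>
      quot_qnorm p (cls X Y x) = 0 \<and> quot_qnorm p (cls X Y x') = 0)"
    if x: "x \<in> carrier X" for x
  proof
    \<comment> \<open>The witness is zero: \<open>x\<close> plus zero is \<open>x\<close>, whose
      class is already zero.\<close>
    assume "cls X Y x = cls X Y \<zero>\<^bsub>X\<^esub>"
    then show "\<exists>x'\<in>carrier X. cls X Y (x \<oplus>\<^bsub>X\<^esub> x') = cls X Y \<zero>\<^bsub>X\<^esub> \<and>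
        quot_qnorm p (cls X Y x) = 0 \<and> quot_qnorm p (cls X Y x') = 0"
      using x quot_qnorm_zero[OF Y] by (intro bexI[of _ "\<zero>\<^bsub>X\<^esub>"]) auto
  qed (use cls_eq_zero_of_quot_qnorm_eq_zero[OF Y assms(3) x] in blast)
  show ?thesis
  proof (intro quasi_normed_cone.intro cancellative_cone_quot_cone[OF Y]
      quasi_normed_cone_axioms.intro)
    fix A assume "A \<in> carrier (quot_cone X Y)"
    then obtain x where x: "x \<in> carrier X" "A = cls X Y x" by (auto simp: quot_simps)
    show "A = \<zero>\<^bsub>quot_cone X Y\<^esub> \<longleftrightarrow> (\<exists>A'\<in>carrier (quot_cone X Y).
        A \<oplus>\<^bsub>quot_cone X Y\<^esub> A' = \<zero>\<^bsub>quot_cone X Y\<^esub> \<and> quot_qnorm p A = 0 \<and> quot_qnorm p A' = 0)"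
      using zero_iff[OF x(1)] x by (simp add: quot_simps)
  qed (auto simp: quot_simps quot_qnorm_nonneg[OF Y] quot_qnorm_smult[OF Y] quot_qnorm_add[OF Y])
qed

end
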